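(* Let $\Gamma=(V,E)$ be an invariant stratification graph with respect to a reference vertex $o\in V$, with strata $V_0=\{o\},V_1,\dots,V_d$ and $n_i=|V_i|$. Let $f$ be a real polynomial, let $H=f(A)$ where $A$ is the adjacency matrix of $\Gamma$, and let $|\psi(t)\rangle=e^{-iHt}|o\rangle$. Then for every $1\le i\le d$ and every time $t$, the entanglement $C_{0i}(t)$ between the reference site $o$ and any vertex of the stratum $V_i$ in the state $|\psi(t)\rangle$ satisfies $$C_{0i}(t)\le \frac{1}{\sqrt{n_i}} .$$
   Context: Graphs are finite, simple and connected; $\partial(x,y)$ is the graph distance. The one-particle space is $K=\mathrm{span}\{|k\rangle:k\in V\}\cong\mathbb{C}^V$ with orthonormal basis $|k\rangle$ (the state in which the qubit at $k$ is up and all others are down), and the adjacency matrix $A$ acts on it. For a reference vertex $o$, the strata are $V_i=\{y\in V:\partial(o,y)=i\}$, $0\le i\le d$, where $d$ is the largest distance from $o$; $n_i=|V_i|$; the stratum states are $|\phi_i\rangle=\frac{1}{\sqrt{n_i}}\sum_{k\in V_i}|k\rangle$, so $|\phi_0\rangle=|o\rangle$. $\Gamma$ is an invariant stratification graph (I.S.G.) with respect to $o$ if $K'=\mathrm{span}\{|\phi_0\rangle,\dots,|\phi_d\rangle\}$ is invariant under $A$. In a one-particle state $|\psi\rangle=\sum_k\upsilon_k|k\rangle$ the entanglement (concurrence) between the qubits at distinct vertices $m,n$ is $C_{mn}=2|\upsilon_m\upsilon_n|$. With $\gamma_i(t)=\langle\phi_i|e^{-if(A)t}|\phi_0\rangle$,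 the entanglement between $o$ and any vertex of $V_i$ ($i\ge1$) in the state $|\psi(t)\rangle$ is $C_{0i}(t)=2|\gamma_0(t)\gamma_i(t)|/\sqrt{n_i}$. *)

theory Defs
  imports "HOL-Analysis.Analysis" "HOL-Computational_Algebra.Polynomial"
begin

section \<open>Graphs and strata\<close>

text \<open>A finite simple connected graph: the vertex set is the finite type \<open>'v\<close>, and \<open>E\<close> is the set
  of ordered pairs of adjacent vertices.\<close>

definition simple_connected_graph :: "('v::finite \<times> 'v) set \<Rightarrow> bool" where
  "simple_connected_graph E \<longleftrightarrow> sym E \<and> irrefl E \<and> (\<forall>x y. (x, y) \<in> E\<^sup>*)"

text \<open>\<open>E ^^ n\<close> relates the endpoints of walks of length \<open>n\<close>.\<close>

definition graph_dist :: "('v::finite \<times> 'v) set \<Rightarrow> 'v \<Rightarrow> 'v \<Rightarrow> nat" where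
  "graph_dist E x y = (LEAST n. (x, y) \<in> E ^^ n)"

definition stratum :: "('v::finite \<times> 'v) set \<Rightarrow> 'v \<Rightarrow> nat \<Rightarrow> 'v set" where
  "stratum E r i = {y. graph_dist E r y = i}"

definition depth :: "('v::finite \<times> 'v) set \<Rightarrow> 'v \<Rightarrow> nat" where
  "depth E r = Max (range (graph_dist E r))"

definition adjacency :: "('v::finite \<times> 'v) set \<Rightarrow> complex^'v^'v" where
  "adjacency E = (\<chi> x y. if (x, y) \<in> E then 1 else 0)"


section \<open>One-particle states\<close>

text \<open>The library inner product on \<open>complex^'v\<close> is only the real part of the Hermitian form.\<close>

definition braket :: "complex^'v \<Rightarrow> complex^'v::finite \<Rightarrow> complex" where
  "braket u w = (\<Sum>k\<in>UNIV. cnj (u $ k) * w $ k)"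

definition ket :: "'v::finite \<Rightarrow> complex^'v" where
  "ket k = axis k 1"

definition stratum_state :: "('v::finite \<times> 'v) set \<Rightarrow> 'v \<Rightarrow> nat \<Rightarrow> complex^'v" where
  "stratum_state E r i =
     (1 / sqrt (real (card (stratum E r i)))) *\<^sub>R (\<Sum>k\<in>stratum E r i. ket k)"

text \<open>\<open>vec.span\<close> is the span over the complex scalars (\<open>span\<close> would be the real span).\<close>

definition stratum_space :: "('v::finite \<times> 'v) set \<Rightarrow> 'v \<Rightarrow> (complex^'v) set" where
  "stratum_space E r = vec.span (stratum_state E r ` {0..depth E r})"

definition invariant_stratification_graph :: "('v::finite \<times> 'v) set \<Rightarrow> 'v \<Rightarrow> bool" where
  "invariant_stratification_graph E r \<longleftrightarrow>
     simple_connected_graph E \<and>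
     (\<forall>u\<in>stratum_space E r. adjacency E *v u \<in> stratum_space E r)"

definition concurrence :: "complex^'v::finite \<Rightarrow> 'v \<Rightarrow> 'v \<Rightarrow> real" where
  "concurrence \<psi> m n = 2 * cmod (\<psi> $ m * \<psi> $ n)"


section \<open>Polynomials and exponentials of matrices\<close>

text \<open>The class operations \<open>*\<close> and \<open>^\<close> and the function \<open>exp\<close> do not give the matrix operations on
  \<open>complex^'v^'v\<close>: there \<open>*\<close> is entrywise.\<close>

definition mat_power :: "complex^'v^'v \<Rightarrow> nat \<Rightarrow> complex^'v^'v::finite" where
  "mat_power M n = (((**) M) ^^ n) (mat 1)"

definition mat_poly :: "real poly \<Rightarrow> complex^'v^'v \<Rightarrow> complex^'v^'v::finite" where
  "mat_poly f M = (\<Sum>j\<le>degree f. coeff f j *\<^sub>R mat_power M j)"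

definition mat_exp :: "complex^'v^'v \<Rightarrow> complex^'v^'v::finite" where
  "mat_exp M = (\<Sum>n. (1 / fact n) *\<^sub>R mat_power M n)"

lemma norm_vec_le_sum: "norm (u :: 'a::real_normed_vector^'n) \<le> (\<Sum>i\<in>UNIV. norm (u $ i))"
  by (simp add: norm_vec_def L2_set_le_sum)

lemma summable_mat_exp:
  fixes M :: "complex^'v^'v::finite"
  shows "summable (\<lambda>n. (1 / fact n) *\<^sub>R mat_power M n)"
proof -
  define B where "B = norm M"
  define c where "c = real CARD('v)"
  have entry: "cmod (M $ i $ j) \<le> B" for i j
    unfolding B_def
    using Finite_Cartesian_Product.norm_nth_le[of "M $ i" j] Finite_Cartesian_Product.norm_nth_le[of M i] by simp
  have B0: "B \<ge> 0" by (simp add: B_def)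
  have pw: "cmod (mat_power M n $ i $ j) \<le> (c * B) ^ n" for n i j
  proof (induction n arbitrary: i j)
    case 0
    then show ?case by (simp add: mat_power_def mat_def)
  next
    case (Suc n)
    have "mat_power M (Suc n) $ i $ j = (\<Sum>k\<in>UNIV. M $ i $ k * mat_power M n $ k $ j)"
      by (simp add: mat_power_def matrix_matrix_mult_def)
    then have "cmod (mat_power M (Suc n) $ i $ j)
        \<le> (\<Sum>k\<in>UNIV. cmod (M $ i $ k * mat_power M n $ k $ j))"
      by (simp add: norm_sum)
    also have "\<dots> \<le> (\<Sum>k\<in>(UNIV::'v set). B * (c * B) ^ n)"
      by (rule sum_mono) (simp add: norm_mult mult_mono entry Suc B0)
    finally show ?case by (simp add: c_def mult.assoc)
  qed
  have "norm (mat_power M n) \<le> c * (c * (c * B) ^ n)" for n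
  proof -
    have "norm (mat_power M n) \<le> (\<Sum>i\<in>(UNIV::'v set). norm (mat_power M n $ i))"
      by (rule norm_vec_le_sum)
    also have "\<dots> \<le> (\<Sum>i\<in>(UNIV::'v set). \<Sum>j\<in>(UNIV::'v set). cmod (mat_power M n $ i $ j))"
      by (rule sum_mono) (rule norm_vec_le_sum)
    also have "\<dots> \<le> (\<Sum>i\<in>(UNIV::'v set). \<Sum>j\<in>(UNIV::'v set). (c * B) ^ n)"
      by (intro sum_mono pw)
    finally show ?thesis by (simp add: c_def)
  qed
  then have le: "norm ((1 / fact n) *\<^sub>R mat_power M n) \<le> (c * c) * (inverse (fact n) * (c * B) ^ n)" for n
    by (simp add: field_simps divide_right_mono)
  have "summable (\<lambda>n. (c * c) * (inverse (fact n) * (c * B) ^ n))"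
    by (intro summable_mult summable_exp)
  then show ?thesis
    using le by (rule summable_comparison_test')
qed


section \<open>Time evolution under a polynomial Hamiltonian\<close>

text \<open>\<open>mat c\<close> is the scalar matrix with diagonal entries \<open>c\<close>.\<close>

definition propagator :: "('v::finite \<times> 'v) set \<Rightarrow> real poly \<Rightarrow> real \<Rightarrow> complex^'v^'v" where
  "propagator E f t = mat_exp (mat (- \<i> * of_real t) ** mat_poly f (adjacency E))"

definition evolved_state :: "('v::finite \<times> 'v) set \<Rightarrow> real poly \<Rightarrow> 'v \<Rightarrow> real \<Rightarrow> complex^'v" where
  "evolved_state E f r t = propagator E f t *v ket r"

definition stratum_amplitude ::
    "('v::finite \<times> 'v) set \<Rightarrow> real poly \<Rightarrow> 'v \<Rightarrow> nat \<Rightarrow> real \<Rightarrow> complex" where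
  "stratum_amplitude E f r i t =
     braket (stratum_state E r i) (propagator E f t *v stratum_state E r 0)"

definition stratum_entanglement ::
    "('v::finite \<times> 'v) set \<Rightarrow> real poly \<Rightarrow> 'v \<Rightarrow> nat \<Rightarrow> real \<Rightarrow> real" where
  "stratum_entanglement E f r i t =
     2 * cmod (stratum_amplitude E f r 0 t * stratum_amplitude E f r i t)
       / sqrt (real (card (stratum E r i)))"

end

theory Submission
  imports Defs
begin

text \<open>Since \<open>K'\<close> is a closed subspace invariant under \<open>A\<close>, it contains \<open>\<psi>(t) = exp (- i t f(A)) |o\<rangle>\<close>;
  so \<open>\<psi>(t)\<close> is constant on every stratum and \<open>\<gamma>\<^sub>i(t) = sqrt n\<^sub>i * \<psi>(t)\<^sub>k\<close> for each \<open>k\<close> in \<open>V\<^sub>i\<close>. As \<open>f(A)\<close> is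
  self-adjoint, \<open>\<psi>(t)\<close> has norm 1, whence \<open>2 |\<gamma>\<^sub>0 \<gamma>\<^sub>i| \<le> |\<gamma>\<^sub>0|\<^sup>2 + |\<gamma>\<^sub>i|\<^sup>2 \<le> 1\<close>.\<close>

section \<open>Hermitian form and matrix functions\<close>

lemma braket_add_left: "braket (u + u') w = braket u w + braket u' w"
  by (simp add: braket_def algebra_simps sum.distrib)

lemma braket_add_right: "braket u (w + w') = braket u w + braket u w'"
  by (simp add: braket_def algebra_simps sum.distrib)

lemma braket_scaleR_left: "braket (a *\<^sub>R u) w = a *\<^sub>R braket u w"
  by (simp add: braket_def scaleR_sum_right)

lemma braket_scaleR_right: "braket u (a *\<^sub>R w) = a *\<^sub>R braket u w"
  by (simp add: braket_def scaleR_sum_right)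

lemma braket_scale_left: "braket (a *s u) w = cnj a * braket u w"
  by (simp add: braket_def sum_distrib_left mult_ac)

lemma braket_scale_right: "braket u (a *s w) = a * braket u w"
  by (simp add: braket_def sum_distrib_left mult_ac)

lemma braket_sum_left: "braket (\<Sum>j\<in>J. u j) w = (\<Sum>j\<in>J. braket (u j) w)"
  by (induction J rule: infinite_finite_induct) (auto simp: braket_add_left, auto simp: braket_def)

lemma braket_sum_right: "braket u (\<Sum>j\<in>J. w j) = (\<Sum>j\<in>J. braket u (w j))"
  by (induction J rule: infinite_finite_induct) (auto simp: braket_add_right, auto simp: braket_def)

text \<open>Linearity in the matrix allows sums and series of matrices to be applied to a vector
  term by term.\<close>

lemma linear_matrix_vector_mult_left: "linear (\<lambda>A::complex^'v^'v::finite. A *v u)"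
  by (rule linearI)
    (simp_all add: vec_eq_iff matrix_vector_mult_def sum.distrib algebra_simps scaleR_sum_right)

lemma mat_power_mult_vec: "mat_power M n *v u = (((*v) M) ^^ n) u"
proof (induction n)
  case (Suc n)
  have "mat_power M (Suc n) *v u = M *v (mat_power M n *v u)"
    by (simp add: mat_power_def matrix_vector_mul_assoc)
  with Suc show ?case by simp
qed (simp add: mat_power_def)

lemma mat_poly_mult_vec:
  "mat_poly f M *v u = (\<Sum>j\<le>degree f. coeff f j *\<^sub>R (((*v) M) ^^ j) u)"
  by (simp add: mat_poly_def linear_sum[OF linear_matrix_vector_mult_left]
      linear_cmul[OF linear_matrix_vector_mult_left] mat_power_mult_vec)

lemma mat_mult_vec:
  fixes M :: "complex^'v^'v::finite"
  shows "(mat c ** M) *v u = c *s (M *v u)"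
proof -
  have "mat c *v w = c *s w" for w :: "complex^'v"
    by (simp add: vec_eq_iff matrix_vector_mult_def mat_def if_distrib[of "\<lambda>x. x * _"] cong: if_cong)
  then show ?thesis by (simp flip: matrix_vector_mul_assoc)
qed

text \<open>Scalars commute with \<open>M\<close>, so they collect into one power. This makes each
  coordinate of \<open>mat_exp (mat s ** M) *v u\<close> a power series in \<open>s\<close>.\<close>

lemma mat_mult_vec_funpow:
  fixes M :: "complex^'v^'v::finite"
  shows "(((*v) (mat c ** M)) ^^ n) u = c ^ n *s (((*v) M) ^^ n) u"
  by (induction n) (simp_all add: mat_mult_vec vector_scalar_commute mult_ac)

text \<open>In finite dimension a linear map is bounded, hence may be exchanged with the exponential
  series.\<close>

lemma mat_exp_mult_vec_sums:
  fixes M :: "complex^'v^'v::finite"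
  shows "(\<lambda>n. (1 / fact n) *\<^sub>R (((*v) M) ^^ n) u) sums (mat_exp M *v u)"
proof -
  have "bounded_linear (\<lambda>A::complex^'v^'v. A *v u)"
    using linear_matrix_vector_mult_left linear_conv_bounded_linear by blast
  from bounded_linear.sums[OF this summable_sums[OF summable_mat_exp[of M]]] show ?thesis
    by (simp only: mat_exp_def linear_cmul[OF linear_matrix_vector_mult_left] mat_power_mult_vec)
qed

text \<open>Bridges complex subspaces to the real notion \<open>subspace\<close>, for which
  closedness is available and which fits the real coefficients of \<open>f\<close> and of the
  exponential series.\<close>

lemma real_subspace_of_vec_subspace:
  fixes K :: "(complex^'v::finite) set"
  assumes "vec.subspace K"
  shows "subspace K"
proof (rule subspaceI)
  fix c :: real and u assume "u \<in> K"
  then have "complex_of_real c *s u \<in> K" using assms by (rule vec.subspace_scale[rotated])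
  also have "complex_of_real c *s u = c *\<^sub>R u" by (simp add: vec_eq_iff scaleR_conv_of_real[where 'a = complex])
  finally show "c *\<^sub>R u \<in> K" .
qed (use assms in \<open>auto intro: vec.subspace_0 vec.subspace_add\<close>)

lemma mat_poly_mem_invariant_subspace:
  assumes K: "vec.subspace K" and inv: "\<And>u. u \<in> K \<Longrightarrow> M *v u \<in> K" and "u \<in> K"
  shows "mat_poly f M *v u \<in> K"
proof -
  have "(((*v) M) ^^ j) u \<in> K" for j
    by (induction j) (auto simp: inv \<open>u \<in> K\<close>)
  then show ?thesis
    unfolding mat_poly_mult_vec
    using real_subspace_of_vec_subspace[OF K] by (intro subspace_sum subspace_scale)
qed

text \<open>The partial sums of the exponential series stay in \<open>K\<close>, and a subspace of a
  finite-dimensional space is closed, so the limit stays there too.\<close>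

lemma mat_exp_mem_invariant_subspace:
  assumes K: "vec.subspace K" and inv: "\<And>u. u \<in> K \<Longrightarrow> M *v u \<in> K" and "u \<in> K"
  shows "mat_exp M *v u \<in> K"
proof -
  have sub: "subspace K" by (rule real_subspace_of_vec_subspace[OF K])
  have "(((*v) M) ^^ j) u \<in> K" for j
    by (induction j) (auto simp: inv \<open>u \<in> K\<close>)
  then have "\<And>N. (\<Sum>n<N. (1 / fact n) *\<^sub>R (((*v) M) ^^ n) u) \<in> K"
    using sub by (intro subspace_sum subspace_scale)
  from closed_sequentially[OF closed_subspace[OF sub] this mat_exp_mult_vec_sums[unfolded sums_def]]
  show ?thesis .
qed


section \<open>Unitarity\<close>

lemma mat_exp_has_field_derivative:
  fixes M :: "complex^'v^'v::finite"
  shows "((\<lambda>s. (mat_exp (mat s ** M) *v u) $ k) has_field_derivative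
           (M *v (mat_exp (mat s ** M) *v u)) $ k) (at s)"
proof -
  define c where "c k n = (((*v) M ^^ n) u) $ k / fact n" for k n
  have c_sums: "(\<lambda>n. c k n * s ^ n) sums ((mat_exp (mat s ** M) *v u) $ k)" for k s
    using bounded_linear.sums[OF bounded_linear_vec_nth mat_exp_mult_vec_sums[of "mat s ** M" u], of k]
    unfolding mat_mult_vec_funpow c_def
    by (simp add: scaleR_conv_of_real[where 'a = complex] mult_ac)
  then have eq: "(mat_exp (mat s ** M) *v u) $ k = (\<Sum>n. c k n * s ^ n)" for k s
    by (simp add: sums_iff)
  \<comment> \<open>The factor \<open>n + 1\<close> from termwise differentiation turns
    \<open>1 / fact (n + 1)\<close> into \<open>1 / fact n\<close>, leaving one extra application of
    \<open>M\<close>.\<close>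
  have diffs: "diffs (c k) n = (\<Sum>j\<in>UNIV. M $ k $ j * c j n)" for n
  proof -
    have "diffs (c k) n = (M *v ((*v) M ^^ n) u) $ k / fact n"
      by (simp add: diffs_def c_def field_simps del: of_nat_Suc)
    then show ?thesis
      by (simp add: matrix_vector_mult_def c_def sum_divide_distrib)
  qed
  have "(\<lambda>n. \<Sum>j\<in>UNIV. M $ k $ j * (c j n * s ^ n)) sums
          (\<Sum>j\<in>UNIV. M $ k $ j * (mat_exp (mat s ** M) *v u) $ j)"
    by (intro sums_sum sums_mult c_sums)
  then have "(\<lambda>n. diffs (c k) n * s ^ n) sums (M *v (mat_exp (mat s ** M) *v u)) $ k"
    by (simp add: diffs sum_distrib_right mult.assoc matrix_vector_mult_def)
  moreover have "((\<lambda>s. \<Sum>n. c k n * s ^ n) has_field_derivative (\<Sum>n. diffs (c k) n * s ^ n)) (at s)"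
    by (rule termdiffs_strong_converges_everywhere) (use c_sums in \<open>auto simp: sums_iff\<close>)
  ultimately show ?thesis
    by (simp add: eq sums_iff)
qed

text \<open>Along the curve \<open>g s\<close>, the exponential of \<open>s\<close> times
  \<open>M\<close> applied to \<open>u\<close>, the derivative of the squared norm is the sum of
  \<open>braket (g s) (M *v g s)\<close> and \<open>braket (M *v g s) (g s)\<close>, which
  cancel.\<close>

lemma braket_mat_exp_skew:
  fixes M :: "complex^'v^'v::finite"
  assumes skew: "\<And>u w. braket (M *v u) w = - braket u (M *v w)"
  shows "braket (mat_exp M *v u) (mat_exp M *v u) = braket u u"
proof -
  \<comment> \<open>The parameter is real because complex conjugation is not complex differentiable.
    The curve runs from \<open>u\<close> at 0 to \<open>mat_exp M *v u\<close> at 1.\<close>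
  define g where "g s = mat_exp (mat (of_real s) ** M) *v u" for s :: real
  have g_deriv: "((\<lambda>s. g s $ k) has_vector_derivative (M *v g s) $ k) (at s)" for k s
    unfolding g_def by (rule has_vector_derivative_real_field[OF mat_exp_has_field_derivative])
  have "((\<lambda>s. braket (g s) (g s)) has_vector_derivative
          (\<Sum>k\<in>UNIV. cnj (g s $ k) * (M *v g s) $ k + cnj ((M *v g s) $ k) * g s $ k)) (at s)" for s
    unfolding braket_def
    by (intro has_vector_derivative_sum has_vector_derivative_mult has_vector_derivative_cnj g_deriv)
  moreover have "(\<Sum>k\<in>UNIV. cnj (g s $ k) * (M *v g s) $ k + cnj ((M *v g s) $ k) * g s $ k) = 0" for s
    using skew[of "g s" "g s"] by (simp add: sum.distrib braket_def)
  ultimately have "((\<lambda>s. braket (g s) (g s)) has_vector_derivative 0) (at s)" for s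
    by simp
  then obtain c where c: "\<And>s. braket (g s) (g s) = c"
    using has_vector_derivative_zero_constant[of UNIV "\<lambda>s. braket (g s) (g s)"] by auto
  have g1: "g 1 = mat_exp M *v u"
    by (simp add: g_def)
  \<comment> \<open>At parameter 0 only the term \<open>n = 0\<close> survives, since
    \<open>0 ^ 0 = 1\<close>.\<close>
  have "(\<lambda>n. (1 / fact n) *\<^sub>R (((*v) (mat 0 ** M)) ^^ n) u) sums u"
    unfolding mat_mult_vec_funpow using sums_single[of 0 "\<lambda>_. u"]
    by (rule sums_cong[THEN iffD1, rotated]) auto
  then have "g 0 = u"
    using sums_unique2[OF mat_exp_mult_vec_sums] by (auto simp: g_def)
  with c[of 0] c[of 1] g1 show ?thesis by simp
qed

text \<open>Powers of \<open>M\<close> cross the form one factor at a time, and the real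
  coefficients of \<open>f\<close> are unchanged by conjugation.\<close>

lemma braket_mat_poly_selfadjoint:
  assumes sa: "\<And>u w. braket (M *v u) w = braket u (M *v w)"
  shows "braket (mat_poly f M *v u) w = braket u (mat_poly f M *v w)"
proof -
  have "braket ((((*v) M) ^^ j) u) w = braket u ((((*v) M) ^^ j) w)" for j
    by (induction j arbitrary: u w) (simp_all add: sa funpow_swap1)
  then show ?thesis
    by (simp add: mat_poly_mult_vec braket_sum_left braket_sum_right
        braket_scaleR_left braket_scaleR_right)
qed

lemma braket_adjacency_selfadjoint:
  assumes "sym E"
  shows "braket (adjacency E *v u) w = braket u (adjacency E *v w)"
proof -
  have swap: "cnj (adjacency E $ x $ y) = adjacency E $ y $ x" for x y
    using assms by (auto simp: adjacency_def sym_def)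
  have "braket (adjacency E *v u) w =
      (\<Sum>x\<in>UNIV. \<Sum>y\<in>UNIV. cnj (u $ y) * (adjacency E $ y $ x * w $ x))"
    by (simp add: braket_def matrix_vector_mult_def swap sum_distrib_left sum_distrib_right mult_ac)
  also have "\<dots> = braket u (adjacency E *v w)"
    by (subst sum.swap) (simp add: braket_def matrix_vector_mult_def sum_distrib_left)
  finally show ?thesis .
qed

lemma braket_evolved_state:
  assumes "sym E"
  shows "braket (evolved_state E f r t) (evolved_state E f r t) = 1"
proof -
  have "braket (ket r) (ket r) = 1"
    by (simp add: braket_def ket_def axis_def if_distrib[of cnj] if_distrib[of "\<lambda>x. x * _"] cong: if_cong)
  \<comment> \<open>Conjugating \<open>- \<i> * t\<close> flips its sign, so this multiple of a
    self-adjoint matrix is skew-adjoint.\<close>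
  moreover have "braket ((mat (- \<i> * of_real t) ** mat_poly f (adjacency E)) *v u) w =
      - braket u ((mat (- \<i> * of_real t) ** mat_poly f (adjacency E)) *v w)" for u w
    unfolding mat_mult_vec braket_scale_left braket_scale_right
      braket_mat_poly_selfadjoint[OF braket_adjacency_selfadjoint[OF assms]]
    by simp
  ultimately show ?thesis
    unfolding evolved_state_def propagator_def by (simp only: braket_mat_exp_skew)
qed


section \<open>States in the span of the stratum states\<close>

text \<open>Connectedness supplies a walk from \<open>r\<close> to \<open>y\<close>, so the
  \<open>LEAST\<close> in \<open>graph_dist\<close> is attained and the value 0 means a walk of
  length 0.\<close>

lemma stratum_zero:
  assumes "simple_connected_graph E"
  shows "stratum E r 0 = {r}"
proof -
  have "y = r" if "graph_dist E r y = 0" for y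
  proof -
    from assms have "(r, y) \<in> E\<^sup>*" by (simp add: simple_connected_graph_def)
    then obtain n where "(r, y) \<in> E ^^ n" using rtrancl_imp_relpow by blast
    then have "(r, y) \<in> E ^^ graph_dist E r y"
      unfolding graph_dist_def by (rule LeastI)
    with that show ?thesis by simp
  qed
  moreover have "graph_dist E r r = 0"
    by (simp add: graph_dist_def)
  ultimately show ?thesis by (auto simp: stratum_def)
qed

lemma stratum_state_zero:
  assumes "simple_connected_graph E"
  shows "stratum_state E r 0 = ket r"
  by (simp add: stratum_state_def stratum_zero[OF assms])

lemma stratum_state_nth:
  "stratum_state E r i $ y = of_real (if y \<in> stratum E r i then 1 / sqrt (card (stratum E r i)) else 0)"
  by (simp add: stratum_state_def ket_def axis_def scaleR_conv_of_real[where 'a = complex])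

text \<open>Equality of two fixed coordinates is a linear condition, so it suffices to check it on
  the generators. Strata are disjoint, so each generator is constant on every stratum.\<close>

lemma stratum_space_constant_on_strata:
  assumes "u \<in> stratum_space E r" and "x \<in> stratum E r i" and "y \<in> stratum E r i"
  shows "u $ x = u $ y"
proof -
  have "vec.span (stratum_state E r ` {0..depth E r}) \<subseteq> {u. u $ x = u $ y}"
    by (rule vec.span_minimal)
      (use assms(2,3) in \<open>auto simp: vec.subspace_def stratum_state_nth, auto simp: stratum_def\<close>)
  with assms(1) show ?thesis by (auto simp: stratum_space_def)
qed

lemma evolved_state_in_stratum_space:
  assumes "invariant_stratification_graph E r"
  shows "evolved_state E f r t \<in> stratum_space E r"
proof -
  have sub: "vec.subspace (stratum_space E r)"
    by (simp add: stratum_space_def)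
  have "stratum_state E r 0 \<in> stratum_space E r"
    unfolding stratum_space_def by (intro vec.span_base) auto
  then have "ket r \<in> stratum_space E r"
    using assms by (simp add: stratum_state_zero invariant_stratification_graph_def)
  \<comment> \<open>Here the span must be complex: the image under \<open>f(A)\<close> is multiplied
    by an imaginary scalar.\<close>
  moreover have "(mat (- \<i> * of_real t) ** mat_poly f (adjacency E)) *v u \<in> stratum_space E r"
    if "u \<in> stratum_space E r" for u
    unfolding mat_mult_vec using assms sub that
    by (intro vec.subspace_scale mat_poly_mem_invariant_subspace)
      (auto simp: invariant_stratification_graph_def)
  ultimately show ?thesis
    unfolding evolved_state_def propagator_def by (intro mat_exp_mem_invariant_subspace[OF sub])
qed

text \<open>All \<open>n\<close> terms of the form equal \<open>u $ k / sqrt n\<close>, where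
  \<open>n\<close> is the size of the stratum.\<close>

lemma braket_stratum_state:
  assumes "u \<in> stratum_space E r" and "k \<in> stratum E r i"
  shows "braket (stratum_state E r i) u = sqrt (card (stratum E r i)) * u $ k"
proof -
  let ?n = "card (stratum E r i)"
  have "braket (stratum_state E r i) u = (\<Sum>y\<in>stratum E r i. of_real (1 / sqrt ?n) * u $ y)"
    unfolding braket_def by (rule sum.mono_neutral_cong_right) (auto simp: stratum_state_nth)
  also have "\<dots> = (\<Sum>y\<in>stratum E r i. of_real (1 / sqrt ?n) * u $ k)"
    by (intro sum.cong refl) (metis assms stratum_space_constant_on_strata)
  also have "\<dots> = of_real (?n / sqrt ?n) * u $ k"
    by simp
  finally show ?thesis by (simp add: real_div_sqrt)
qed

text \<open>The formula in stratum amplitudes mentions no vertex; the first conjunct ties it to the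
  concurrence at each \<open>k\<close>, so that the second bounds the latter.\<close>

theorem mainTheorem1:
  fixes E :: "('v::finite \<times> 'v) set" and r :: 'v and f :: "real poly" and i :: nat and t :: real
  assumes "invariant_stratification_graph E r"
    and "1 \<le> i" and "i \<le> depth E r"
  shows "(\<forall>k\<in>stratum E r i.
            concurrence (evolved_state E f r t) r k = stratum_entanglement E f r i t)
         \<and> stratum_entanglement E f r i t \<le> 1 / sqrt (real (card (stratum E r i)))"
proof -
  let ?V = "stratum E r i"
  define \<psi> where "\<psi> = evolved_state E f r t"
  have G: "simple_connected_graph E"
    using assms(1) by (simp add: invariant_stratification_graph_def)
  have \<psi>: "\<psi> \<in> stratum_space E r"
    unfolding \<psi>_def by (rule evolved_state_in_stratum_space[OF assms(1)])
  have amp: "stratum_amplitude E f r j t = braket (stratum_state E r j) \<psi>" for j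
    by (simp add: stratum_amplitude_def \<psi>_def evolved_state_def stratum_state_zero[OF G])
  have amp0: "stratum_amplitude E f r 0 t = \<psi> $ r"
    using braket_stratum_state[OF \<psi>, of r 0] by (simp add: amp stratum_zero[OF G])
  have ent: "stratum_entanglement E f r i t = 2 * cmod (\<psi> $ r * \<psi> $ k)" if "k \<in> ?V" for k
  proof -
    \<comment> \<open>Nonemptiness makes the root of the stratum size nonzero, so it cancels against
      the same factor in the amplitude.\<close>
    have "?V \<noteq> {}" using that by blast
    then show ?thesis
      by (simp add: stratum_entanglement_def amp0 amp[of i] braket_stratum_state[OF \<psi> that] norm_mult)
  qed
  have bound: "2 * cmod (\<psi> $ r * stratum_amplitude E f r i t) \<le> 1"
  proof (cases "?V = {}")
    \<comment> \<open>Over an empty stratum the stratum state is the zero vector and the amplitude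
      vanishes.\<close>
    case True
    then show ?thesis by (simp add: amp braket_def stratum_state_nth)
  next
    case False
    then obtain k where k: "k \<in> ?V" by blast
    \<comment> \<open>From \<open>1 \<le> i\<close>, the sites \<open>r\<close> and
      \<open>?V\<close> contribute separately to the total probability 1.\<close>
    have "r \<notin> ?V" using stratum_zero[OF G, of r] assms(2) by (auto simp: stratum_def)
    have "(\<Sum>y\<in>UNIV. (cmod (\<psi> $ y))\<^sup>2) = 1"
    proof -
      have "complex_of_real (\<Sum>y\<in>UNIV. (cmod (\<psi> $ y))\<^sup>2) = braket \<psi> \<psi>"
        by (simp add: braket_def complex_norm_square mult.commute del: of_real_power)
      also have "\<dots> = 1"
        unfolding \<psi>_def using G by (simp add: braket_evolved_state simple_connected_graph_def)
      finally show ?thesis by (simp only: of_real_eq_1_iff)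
    qed
    moreover have "(\<Sum>y\<in>insert r ?V. (cmod (\<psi> $ y))\<^sup>2) \<le> (\<Sum>y\<in>UNIV. (cmod (\<psi> $ y))\<^sup>2)"
      by (rule sum_mono2) auto
    moreover have "(\<Sum>y\<in>insert r ?V. (cmod (\<psi> $ y))\<^sup>2)
        = (cmod (\<psi> $ r))\<^sup>2 + (\<Sum>y\<in>?V. (cmod (\<psi> $ y))\<^sup>2)"
      using \<open>r \<notin> ?V\<close> by simp
    moreover have "(\<Sum>y\<in>?V. (cmod (\<psi> $ y))\<^sup>2) = (\<Sum>y\<in>?V. (cmod (\<psi> $ k))\<^sup>2)"
      by (intro sum.cong refl) (metis \<psi> k stratum_space_constant_on_strata)
    \<comment> \<open>The stratum carries exactly the probability of its stratum state, because the
      state is constant on it.\<close>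
    moreover have "\<dots> = (cmod (stratum_amplitude E f r i t))\<^sup>2"
      by (simp add: amp braket_stratum_state[OF \<psi> k] norm_mult power_mult_distrib)
    ultimately have "(cmod (\<psi> $ r))\<^sup>2 + (cmod (stratum_amplitude E f r i t))\<^sup>2 \<le> 1"
      by simp
    moreover have "2 * cmod (\<psi> $ r) * cmod (stratum_amplitude E f r i t)
        \<le> (cmod (\<psi> $ r))\<^sup>2 + (cmod (stratum_amplitude E f r i t))\<^sup>2"
      by (rule sum_squares_bound)
    ultimately show ?thesis by (simp add: norm_mult mult.assoc)
  qed
  have "stratum_entanglement E f r i t \<le> 1 / sqrt (card ?V)"
    unfolding stratum_entanglement_def amp0 by (intro divide_right_mono bound) simp
  then show ?thesis
    using ent by (simp add: concurrence_def \<psi>_def)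
qed

end
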